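(* The following data define a lax symmetric monoidal functor $\mathsf{NDD}_D\colon(\mathbf{FinSet},+)\to(\mathbf{Set},\times)$. (i) On objects, $\mathsf{NDD}_D$ takes a finite set $N$ to the set of functions $\mathbb{R}^N\to P\mathbb{R}^N$. (ii) For a function $\phi\colon N\to M$, the map $\mathsf{NDD}_D(\phi)\colon\mathsf{NDD}_D(N)\to\mathsf{NDD}_D(M)$ is $$\upsilon\mapsto\eta_{\mathbb{R}^M}\boxplus \bigl(P\phi_*\circ(\upsilon\boxminus\eta_{\mathbb{R}^N})\circ\phi^*\bigr).$$ (iii) The product comparison is $(\upsilon,\rho)\mapsto(P\iota_{N*}\circ\upsilon\circ\iota_N^* )\boxplus(P\iota_{M*}\circ\rho\circ\iota_M^* )$ for $\upsilon\in\mathsf{NDD}_D(N)$, $\rho\in\mathsf{NDD}_D(M)$, and the unit comparison $\{*\}\to\mathsf{NDD}_D(\emptyset)$ picks the function $\mathbb{R}^0\to P\mathbb{R}^0$, $0\mapsto\{0\}$.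
   Context: $(\mathbf{FinSet},+)$ is finite sets with disjoint union as monoidal product; $(\mathbf{Set},\times)$ is sets with Cartesian product. $P\colon\mathbf{Set}\to\mathbf{Set}$ is the covariant powerset functor: $P(X)$ is the set of all subsets of $X$, and $P(f)(A)$ is the image of $A$ under $f$. $\eta_X\colon X\to PX$ is $x\mapsto\{x\}$. For a finite set $N$, $\mathbb{R}^N$ is the vector space of functions $N\to\mathbb{R}$, and $P\mathbb{R}^N$ is the powerset of its underlying set. For $\phi\colon N\to M$, $\phi^*\colon\mathbb{R}^M\to\mathbb{R}^N$ is $\phi^*(y)_i=y_{\phi(i)}$ and $\phi_*\colon\mathbb{R}^N\to\mathbb{R}^M$ is $\phi_*(x)_j=\sum_{i\in\phi^{-1}(j)}x_i$. $\iota_N,\iota_M$ are the inclusions of $N,M$ into $N+M$. $A\boxplus B=\{a+b\mid a\in A,b\in B\}$ is the Minkowski sum and $A\boxminus B=A\boxplus(-B)$ the Minkowski difference; both are applied pointwise to set-valued functions. *)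

theory Defs
  imports Complex_Main "HOL-Library.FuncSet"
begin

section \<open>Symmetric monoidal categories and lax symmetric monoidal functors\<close>

text \<open>
  Categories are given by families of hom-sets. Hom-sets of different pairs of objects need not be
  disjoint, so identities, composition and all structure maps carry their objects as arguments:
  \<open>Cmp C X Y Z g f\<close> is the composite of \<open>f : X \<rightarrow> Y\<close> and \<open>g : Y \<rightarrow> Z\<close>. Nothing is required of these
  operations outside the objects and hom-sets.
\<close>

record ('o, 'm) cat =
  Ob    :: "'o set"
  Hom   :: "'o \<Rightarrow> 'o \<Rightarrow> 'm set"
  Ident :: "'o \<Rightarrow> 'm"
  Cmp   :: "'o \<Rightarrow> 'o \<Rightarrow> 'o \<Rightarrow> 'm \<Rightarrow> 'm \<Rightarrow> 'm"

locale category =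
  fixes C :: "('o, 'm, 'z) cat_scheme" (structure)
  assumes Ident_in: "X \<in> Ob C \<Longrightarrow> Ident C X \<in> Hom C X X"
    and Cmp_in: "\<lbrakk>X \<in> Ob C; Y \<in> Ob C; Z \<in> Ob C; f \<in> Hom C X Y; g \<in> Hom C Y Z\<rbrakk>
      \<Longrightarrow> Cmp C X Y Z g f \<in> Hom C X Z"
    and Cmp_Ident_right: "\<lbrakk>X \<in> Ob C; Y \<in> Ob C; f \<in> Hom C X Y\<rbrakk> \<Longrightarrow> Cmp C X X Y f (Ident C X) = f"
    and Cmp_Ident_left: "\<lbrakk>X \<in> Ob C; Y \<in> Ob C; f \<in> Hom C X Y\<rbrakk> \<Longrightarrow> Cmp C X Y Y (Ident C Y) f = f"
    and Cmp_assoc: "\<lbrakk>W \<in> Ob C; X \<in> Ob C; Y \<in> Ob C; Z \<in> Ob C;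
        f \<in> Hom C W X; g \<in> Hom C X Y; h \<in> Hom C Y Z\<rbrakk>
      \<Longrightarrow> Cmp C W Y Z h (Cmp C W X Y g f) = Cmp C W X Z (Cmp C X Y Z h g) f"

definition is_iso :: "('o, 'm, 'z) cat_scheme \<Rightarrow> 'o \<Rightarrow> 'o \<Rightarrow> 'm \<Rightarrow> bool" where
  "is_iso C X Y f \<longleftrightarrow> f \<in> Hom C X Y \<and>
     (\<exists>g \<in> Hom C Y X. Cmp C X Y X g f = Ident C X \<and> Cmp C Y X Y f g = Ident C Y)"

text \<open>
  \<open>TenM C X X' Y Y' f g : X \<otimes> Y \<rightarrow> X' \<otimes> Y'\<close> is the tensor of \<open>f : X \<rightarrow> X'\<close> and \<open>g : Y \<rightarrow> Y'\<close>. The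
  structure maps are \<open>Assoc C X Y Z : (X \<otimes> Y) \<otimes> Z \<rightarrow> X \<otimes> (Y \<otimes> Z)\<close>, \<open>LUnit C X : I \<otimes> X \<rightarrow> X\<close>,
  \<open>RUnit C X : X \<otimes> I \<rightarrow> X\<close> and \<open>Sym C X Y : X \<otimes> Y \<rightarrow> Y \<otimes> X\<close>.
\<close>

record ('o, 'm) smcat = "('o, 'm) cat" +
  Ten   :: "'o \<Rightarrow> 'o \<Rightarrow> 'o" (infixr "\<otimes>\<index>" 70)
  TenM  :: "'o \<Rightarrow> 'o \<Rightarrow> 'o \<Rightarrow> 'o \<Rightarrow> 'm \<Rightarrow> 'm \<Rightarrow> 'm"
  Unit  :: "'o"
  Assoc :: "'o \<Rightarrow> 'o \<Rightarrow> 'o \<Rightarrow> 'm"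
  LUnit :: "'o \<Rightarrow> 'm"
  RUnit :: "'o \<Rightarrow> 'm"
  Sym   :: "'o \<Rightarrow> 'o \<Rightarrow> 'm"

locale symmetric_monoidal_category = category C for C :: "('o, 'm, 'z) smcat_scheme" (structure) +
  assumes Ten_in: "\<lbrakk>X \<in> Ob C; Y \<in> Ob C\<rbrakk> \<Longrightarrow> X \<otimes> Y \<in> Ob C"
    and Unit_in: "Unit C \<in> Ob C"
    and TenM_in: "\<lbrakk>X \<in> Ob C; X' \<in> Ob C; Y \<in> Ob C; Y' \<in> Ob C; f \<in> Hom C X X'; g \<in> Hom C Y Y'\<rbrakk>
      \<Longrightarrow> TenM C X X' Y Y' f g \<in> Hom C (X \<otimes> Y) (X' \<otimes> Y')"
    and TenM_Ident: "\<lbrakk>X \<in> Ob C; Y \<in> Ob C\<rbrakk>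
      \<Longrightarrow> TenM C X X Y Y (Ident C X) (Ident C Y) = Ident C (X \<otimes> Y)"
    and TenM_Cmp: "\<lbrakk>X \<in> Ob C; X' \<in> Ob C; X'' \<in> Ob C; Y \<in> Ob C; Y' \<in> Ob C; Y'' \<in> Ob C;
        f \<in> Hom C X X'; f' \<in> Hom C X' X''; g \<in> Hom C Y Y'; g' \<in> Hom C Y' Y''\<rbrakk>
      \<Longrightarrow> TenM C X X'' Y Y'' (Cmp C X X' X'' f' f) (Cmp C Y Y' Y'' g' g)
        = Cmp C (X \<otimes> Y) (X' \<otimes> Y') (X'' \<otimes> Y'') (TenM C X' X'' Y' Y'' f' g') (TenM C X X' Y Y' f g)"
    and Assoc_iso: "\<lbrakk>X \<in> Ob C; Y \<in> Ob C; Z \<in> Ob C\<rbrakk>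
      \<Longrightarrow> is_iso C ((X \<otimes> Y) \<otimes> Z) (X \<otimes> (Y \<otimes> Z)) (Assoc C X Y Z)"
    and LUnit_iso: "X \<in> Ob C \<Longrightarrow> is_iso C (Unit C \<otimes> X) X (LUnit C X)"
    and RUnit_iso: "X \<in> Ob C \<Longrightarrow> is_iso C (X \<otimes> Unit C) X (RUnit C X)"
    and Sym_in: "\<lbrakk>X \<in> Ob C; Y \<in> Ob C\<rbrakk> \<Longrightarrow> Sym C X Y \<in> Hom C (X \<otimes> Y) (Y \<otimes> X)"
    and Assoc_natural: "\<lbrakk>X \<in> Ob C; X' \<in> Ob C; Y \<in> Ob C; Y' \<in> Ob C; Z \<in> Ob C; Z' \<in> Ob C;
        f \<in> Hom C X X'; g \<in> Hom C Y Y'; h \<in> Hom C Z Z'\<rbrakk>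
      \<Longrightarrow> Cmp C ((X \<otimes> Y) \<otimes> Z) ((X' \<otimes> Y') \<otimes> Z') (X' \<otimes> (Y' \<otimes> Z'))
            (Assoc C X' Y' Z') (TenM C (X \<otimes> Y) (X' \<otimes> Y') Z Z' (TenM C X X' Y Y' f g) h)
        = Cmp C ((X \<otimes> Y) \<otimes> Z) (X \<otimes> (Y \<otimes> Z)) (X' \<otimes> (Y' \<otimes> Z'))
            (TenM C X X' (Y \<otimes> Z) (Y' \<otimes> Z') f (TenM C Y Y' Z Z' g h)) (Assoc C X Y Z)"
    and LUnit_natural: "\<lbrakk>X \<in> Ob C; X' \<in> Ob C; f \<in> Hom C X X'\<rbrakk>
      \<Longrightarrow> Cmp C (Unit C \<otimes> X) (Unit C \<otimes> X') X'
            (LUnit C X') (TenM C (Unit C) (Unit C) X X' (Ident C (Unit C)) f)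
        = Cmp C (Unit C \<otimes> X) X X' f (LUnit C X)"
    and RUnit_natural: "\<lbrakk>X \<in> Ob C; X' \<in> Ob C; f \<in> Hom C X X'\<rbrakk>
      \<Longrightarrow> Cmp C (X \<otimes> Unit C) (X' \<otimes> Unit C) X'
            (RUnit C X') (TenM C X X' (Unit C) (Unit C) f (Ident C (Unit C)))
        = Cmp C (X \<otimes> Unit C) X X' f (RUnit C X)"
    and Sym_natural: "\<lbrakk>X \<in> Ob C; X' \<in> Ob C; Y \<in> Ob C; Y' \<in> Ob C; f \<in> Hom C X X'; g \<in> Hom C Y Y'\<rbrakk>
      \<Longrightarrow> Cmp C (X \<otimes> Y) (X' \<otimes> Y') (Y' \<otimes> X') (Sym C X' Y') (TenM C X X' Y Y' f g)
        = Cmp C (X \<otimes> Y) (Y \<otimes> X) (Y' \<otimes> X') (TenM C Y Y' X X' g f) (Sym C X Y)"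
    and pentagon: "\<lbrakk>W \<in> Ob C; X \<in> Ob C; Y \<in> Ob C; Z \<in> Ob C\<rbrakk>
      \<Longrightarrow> Cmp C (((W \<otimes> X) \<otimes> Y) \<otimes> Z) ((W \<otimes> X) \<otimes> (Y \<otimes> Z)) (W \<otimes> (X \<otimes> (Y \<otimes> Z)))
            (Assoc C W X (Y \<otimes> Z)) (Assoc C (W \<otimes> X) Y Z)
        = Cmp C (((W \<otimes> X) \<otimes> Y) \<otimes> Z) (W \<otimes> ((X \<otimes> Y) \<otimes> Z)) (W \<otimes> (X \<otimes> (Y \<otimes> Z)))
            (TenM C W W ((X \<otimes> Y) \<otimes> Z) (X \<otimes> (Y \<otimes> Z)) (Ident C W) (Assoc C X Y Z))
            (Cmp C (((W \<otimes> X) \<otimes> Y) \<otimes> Z) ((W \<otimes> (X \<otimes> Y)) \<otimes> Z) (W \<otimes> ((X \<otimes> Y) \<otimes> Z))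
              (Assoc C W (X \<otimes> Y) Z)
              (TenM C ((W \<otimes> X) \<otimes> Y) (W \<otimes> (X \<otimes> Y)) Z Z (Assoc C W X Y) (Ident C Z)))"
    and triangle: "\<lbrakk>X \<in> Ob C; Y \<in> Ob C\<rbrakk>
      \<Longrightarrow> Cmp C ((X \<otimes> Unit C) \<otimes> Y) (X \<otimes> (Unit C \<otimes> Y)) (X \<otimes> Y)
            (TenM C X X (Unit C \<otimes> Y) Y (Ident C X) (LUnit C Y)) (Assoc C X (Unit C) Y)
        = TenM C (X \<otimes> Unit C) X Y Y (RUnit C X) (Ident C Y)"
    and hexagon: "\<lbrakk>X \<in> Ob C; Y \<in> Ob C; Z \<in> Ob C\<rbrakk>
      \<Longrightarrow> Cmp C ((X \<otimes> Y) \<otimes> Z) ((Y \<otimes> Z) \<otimes> X) (Y \<otimes> (Z \<otimes> X)) (Assoc C Y Z X)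
            (Cmp C ((X \<otimes> Y) \<otimes> Z) (X \<otimes> (Y \<otimes> Z)) ((Y \<otimes> Z) \<otimes> X) (Sym C X (Y \<otimes> Z)) (Assoc C X Y Z))
        = Cmp C ((X \<otimes> Y) \<otimes> Z) (Y \<otimes> (X \<otimes> Z)) (Y \<otimes> (Z \<otimes> X))
            (TenM C Y Y (X \<otimes> Z) (Z \<otimes> X) (Ident C Y) (Sym C X Z))
            (Cmp C ((X \<otimes> Y) \<otimes> Z) ((Y \<otimes> X) \<otimes> Z) (Y \<otimes> (X \<otimes> Z)) (Assoc C Y X Z)
              (TenM C (X \<otimes> Y) (Y \<otimes> X) Z Z (Sym C X Y) (Ident C Z)))"
    and Sym_involutive: "\<lbrakk>X \<in> Ob C; Y \<in> Ob C\<rbrakk>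
      \<Longrightarrow> Cmp C (X \<otimes> Y) (Y \<otimes> X) (X \<otimes> Y) (Sym C Y X) (Sym C X Y) = Ident C (X \<otimes> Y)"

text \<open>
  The data of a lax monoidal functor: \<open>Mult F X Y : F X \<otimes> F Y \<rightarrow> F (X \<otimes> Y)\<close> is the product comparison
  and \<open>UnitC F : I \<rightarrow> F I\<close> the unit comparison.
\<close>

record ('o, 'm, 'p, 'n) lax_functor_data =
  FOb   :: "'o \<Rightarrow> 'p"
  FHom  :: "'o \<Rightarrow> 'o \<Rightarrow> 'm \<Rightarrow> 'n"
  Mult  :: "'o \<Rightarrow> 'o \<Rightarrow> 'n"
  UnitC :: "'n"

locale lax_symmetric_monoidal_functor =
  C: symmetric_monoidal_category C + D: symmetric_monoidal_category D
  for C :: "('o, 'm, 'y) smcat_scheme" (structure)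
    and D :: "('p, 'n, 'z) smcat_scheme" (structure) +
  fixes F :: "('o, 'm, 'p, 'n) lax_functor_data"
  assumes FOb_in: "X \<in> Ob C \<Longrightarrow> FOb F X \<in> Ob D"
    and FHom_in: "\<lbrakk>X \<in> Ob C; Y \<in> Ob C; f \<in> Hom C X Y\<rbrakk> \<Longrightarrow> FHom F X Y f \<in> Hom D (FOb F X) (FOb F Y)"
    and FHom_Ident: "X \<in> Ob C \<Longrightarrow> FHom F X X (Ident C X) = Ident D (FOb F X)"
    and FHom_Cmp: "\<lbrakk>X \<in> Ob C; Y \<in> Ob C; Z \<in> Ob C; f \<in> Hom C X Y; g \<in> Hom C Y Z\<rbrakk>
      \<Longrightarrow> FHom F X Z (Cmp C X Y Z g f)
        = Cmp D (FOb F X) (FOb F Y) (FOb F Z) (FHom F Y Z g) (FHom F X Y f)"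
    and Mult_in: "\<lbrakk>X \<in> Ob C; Y \<in> Ob C\<rbrakk>
      \<Longrightarrow> Mult F X Y \<in> Hom D (FOb F X \<otimes>\<^bsub>D\<^esub> FOb F Y) (FOb F (X \<otimes>\<^bsub>C\<^esub> Y))"
    and UnitC_in: "UnitC F \<in> Hom D (Unit D) (FOb F (Unit C))"
    and Mult_natural: "\<lbrakk>X \<in> Ob C; X' \<in> Ob C; Y \<in> Ob C; Y' \<in> Ob C; f \<in> Hom C X X'; g \<in> Hom C Y Y'\<rbrakk>
      \<Longrightarrow> Cmp D (FOb F X \<otimes>\<^bsub>D\<^esub> FOb F Y) (FOb F X' \<otimes>\<^bsub>D\<^esub> FOb F Y') (FOb F (X' \<otimes>\<^bsub>C\<^esub> Y'))
            (Mult F X' Y')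
            (TenM D (FOb F X) (FOb F X') (FOb F Y) (FOb F Y') (FHom F X X' f) (FHom F Y Y' g))
        = Cmp D (FOb F X \<otimes>\<^bsub>D\<^esub> FOb F Y) (FOb F (X \<otimes>\<^bsub>C\<^esub> Y)) (FOb F (X' \<otimes>\<^bsub>C\<^esub> Y'))
            (FHom F (X \<otimes>\<^bsub>C\<^esub> Y) (X' \<otimes>\<^bsub>C\<^esub> Y') (TenM C X X' Y Y' f g))
            (Mult F X Y)"
    and Mult_Assoc: "\<lbrakk>X \<in> Ob C; Y \<in> Ob C; Z \<in> Ob C\<rbrakk>
      \<Longrightarrow> Cmp D ((FOb F X \<otimes>\<^bsub>D\<^esub> FOb F Y) \<otimes>\<^bsub>D\<^esub> FOb F Z) (FOb F ((X \<otimes>\<^bsub>C\<^esub> Y) \<otimes>\<^bsub>C\<^esub> Z))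
              (FOb F (X \<otimes>\<^bsub>C\<^esub> (Y \<otimes>\<^bsub>C\<^esub> Z)))
            (FHom F ((X \<otimes>\<^bsub>C\<^esub> Y) \<otimes>\<^bsub>C\<^esub> Z) (X \<otimes>\<^bsub>C\<^esub> (Y \<otimes>\<^bsub>C\<^esub> Z)) (Assoc C X Y Z))
            (Cmp D ((FOb F X \<otimes>\<^bsub>D\<^esub> FOb F Y) \<otimes>\<^bsub>D\<^esub> FOb F Z) (FOb F (X \<otimes>\<^bsub>C\<^esub> Y) \<otimes>\<^bsub>D\<^esub> FOb F Z)
                (FOb F ((X \<otimes>\<^bsub>C\<^esub> Y) \<otimes>\<^bsub>C\<^esub> Z))
              (Mult F (X \<otimes>\<^bsub>C\<^esub> Y) Z)
              (TenM D (FOb F X \<otimes>\<^bsub>D\<^esub> FOb F Y) (FOb F (X \<otimes>\<^bsub>C\<^esub> Y)) (FOb F Z) (FOb F Z)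
                (Mult F X Y) (Ident D (FOb F Z))))
        = Cmp D ((FOb F X \<otimes>\<^bsub>D\<^esub> FOb F Y) \<otimes>\<^bsub>D\<^esub> FOb F Z) (FOb F X \<otimes>\<^bsub>D\<^esub> FOb F (Y \<otimes>\<^bsub>C\<^esub> Z))
              (FOb F (X \<otimes>\<^bsub>C\<^esub> (Y \<otimes>\<^bsub>C\<^esub> Z)))
            (Mult F X (Y \<otimes>\<^bsub>C\<^esub> Z))
            (Cmp D ((FOb F X \<otimes>\<^bsub>D\<^esub> FOb F Y) \<otimes>\<^bsub>D\<^esub> FOb F Z) (FOb F X \<otimes>\<^bsub>D\<^esub> (FOb F Y \<otimes>\<^bsub>D\<^esub> FOb F Z))
                (FOb F X \<otimes>\<^bsub>D\<^esub> FOb F (Y \<otimes>\<^bsub>C\<^esub> Z))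
              (TenM D (FOb F X) (FOb F X) (FOb F Y \<otimes>\<^bsub>D\<^esub> FOb F Z) (FOb F (Y \<otimes>\<^bsub>C\<^esub> Z))
                (Ident D (FOb F X)) (Mult F Y Z))
              (Assoc D (FOb F X) (FOb F Y) (FOb F Z)))"
    and Mult_LUnit: "X \<in> Ob C
      \<Longrightarrow> Cmp D (Unit D \<otimes>\<^bsub>D\<^esub> FOb F X) (FOb F (Unit C \<otimes>\<^bsub>C\<^esub> X)) (FOb F X)
            (FHom F (Unit C \<otimes>\<^bsub>C\<^esub> X) X (LUnit C X))
            (Cmp D (Unit D \<otimes>\<^bsub>D\<^esub> FOb F X) (FOb F (Unit C) \<otimes>\<^bsub>D\<^esub> FOb F X) (FOb F (Unit C \<otimes>\<^bsub>C\<^esub> X))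
              (Mult F (Unit C) X)
              (TenM D (Unit D) (FOb F (Unit C)) (FOb F X) (FOb F X) (UnitC F) (Ident D (FOb F X))))
        = LUnit D (FOb F X)"
    and Mult_RUnit: "X \<in> Ob C
      \<Longrightarrow> Cmp D (FOb F X \<otimes>\<^bsub>D\<^esub> Unit D) (FOb F (X \<otimes>\<^bsub>C\<^esub> Unit C)) (FOb F X)
            (FHom F (X \<otimes>\<^bsub>C\<^esub> Unit C) X (RUnit C X))
            (Cmp D (FOb F X \<otimes>\<^bsub>D\<^esub> Unit D) (FOb F X \<otimes>\<^bsub>D\<^esub> FOb F (Unit C)) (FOb F (X \<otimes>\<^bsub>C\<^esub> Unit C))
              (Mult F X (Unit C))
              (TenM D (FOb F X) (FOb F X) (Unit D) (FOb F (Unit C)) (Ident D (FOb F X)) (UnitC F)))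
        = RUnit D (FOb F X)"
    and Mult_Sym: "\<lbrakk>X \<in> Ob C; Y \<in> Ob C\<rbrakk>
      \<Longrightarrow> Cmp D (FOb F X \<otimes>\<^bsub>D\<^esub> FOb F Y) (FOb F (X \<otimes>\<^bsub>C\<^esub> Y)) (FOb F (Y \<otimes>\<^bsub>C\<^esub> X))
            (FHom F (X \<otimes>\<^bsub>C\<^esub> Y) (Y \<otimes>\<^bsub>C\<^esub> X) (Sym C X Y)) (Mult F X Y)
        = Cmp D (FOb F X \<otimes>\<^bsub>D\<^esub> FOb F Y) (FOb F Y \<otimes>\<^bsub>D\<^esub> FOb F X) (FOb F (Y \<otimes>\<^bsub>C\<^esub> X))
            (Mult F Y X) (Sym D (FOb F X) (FOb F Y))"


section \<open>Finite sets with disjoint union\<close>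

text \<open>
  To have a single type of finite sets that is closed under disjoint union, elements are drawn from
  the closure of an arbitrary type \<^typ>\<open>'a\<close> of atoms under two injections. A morphism
  \<open>N \<rightarrow> M\<close> is a function in \<open>N \<rightarrow>\<^sub>E M\<close>, i.e. a HOL function with the junk value \<open>undefined\<close> off \<open>N\<close>.
\<close>

datatype 'a copr = Atom 'a | Inj1 "'a copr" | Inj2 "'a copr"

definition dsum :: "'a copr set \<Rightarrow> 'a copr set \<Rightarrow> 'a copr set" (infixr "\<oplus>" 65) where
  "N \<oplus> M = Inj1 ` N \<union> Inj2 ` M"

definition FinSet :: "('a copr set, 'a copr \<Rightarrow> 'a copr) smcat" where
  "FinSet = \<lparr>
     Ob = {N. finite N},
     Hom = (\<lambda>N M. N \<rightarrow>\<^sub>E M),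
     Ident = (\<lambda>N. \<lambda>i\<in>N. i),
     Cmp = (\<lambda>N M L \<psi> \<phi>. compose N \<psi> \<phi>),
     Ten = (\<oplus>),
     TenM = (\<lambda>N N' M M' \<phi> \<psi>. \<lambda>k\<in>N \<oplus> M.
       case k of Inj1 i \<Rightarrow> Inj1 (\<phi> i) | Inj2 j \<Rightarrow> Inj2 (\<psi> j) | _ \<Rightarrow> undefined),
     Unit = {},
     Assoc = (\<lambda>N M L. \<lambda>k\<in>(N \<oplus> M) \<oplus> L.
       case k of Inj1 (Inj1 i) \<Rightarrow> Inj1 i | Inj1 (Inj2 j) \<Rightarrow> Inj2 (Inj1 j) | Inj2 l \<Rightarrow> Inj2 (Inj2 l)
         | _ \<Rightarrow> undefined),
     LUnit = (\<lambda>N. \<lambda>k\<in>{} \<oplus> N. case k of Inj2 i \<Rightarrow> i | _ \<Rightarrow> undefined),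
     RUnit = (\<lambda>N. \<lambda>k\<in>N \<oplus> {}. case k of Inj1 i \<Rightarrow> i | _ \<Rightarrow> undefined),
     Sym = (\<lambda>N M. \<lambda>k\<in>N \<oplus> M.
       case k of Inj1 i \<Rightarrow> Inj2 i | Inj2 j \<Rightarrow> Inj1 j | _ \<Rightarrow> undefined)\<rparr>"


section \<open>Sets with Cartesian product\<close>

text \<open>
  Likewise, elements of sets are drawn from the closure of an arbitrary type \<^typ>\<open>'b\<close> under
  a point \<open>Star\<close> (the element of the unit object) and pairing; \<^typ>\<open>'b\<close> embeds via \<open>Base\<close>.
\<close>

datatype 'b tup = Base (un_Base: 'b) | Star | Pr (pr1: "'b tup") (pr2: "'b tup")

definition cprod :: "'b tup set \<Rightarrow> 'b tup set \<Rightarrow> 'b tup set" where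
  "cprod S T = {Pr s t | s t. s \<in> S \<and> t \<in> T}"

definition SetCat :: "('b tup set, 'b tup \<Rightarrow> 'b tup) smcat" where
  "SetCat = \<lparr>
     Ob = UNIV,
     Hom = (\<lambda>S T. S \<rightarrow>\<^sub>E T),
     Ident = (\<lambda>S. \<lambda>s\<in>S. s),
     Cmp = (\<lambda>S T U g f. compose S g f),
     Ten = cprod,
     TenM = (\<lambda>S S' T T' f g. \<lambda>z\<in>cprod S T. Pr (f (pr1 z)) (g (pr2 z))),
     Unit = {Star},
     Assoc = (\<lambda>S T U. \<lambda>z\<in>cprod (cprod S T) U. Pr (pr1 (pr1 z)) (Pr (pr2 (pr1 z)) (pr2 z))),
     LUnit = (\<lambda>S. \<lambda>z\<in>cprod {Star} S. pr2 z),
     RUnit = (\<lambda>S. \<lambda>z\<in>cprod S {Star}. pr1 z),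
     Sym = (\<lambda>S T. \<lambda>z\<in>cprod S T. Pr (pr2 z) (pr1 z))\<rparr>"


section \<open>Real vectors indexed by a finite set\<close>

definition Rvec :: "'n set \<Rightarrow> ('n \<Rightarrow> real) set" where
  "Rvec N = N \<rightarrow>\<^sub>E UNIV"

definition pull :: "'n set \<Rightarrow> ('n \<Rightarrow> 'm) \<Rightarrow> ('m \<Rightarrow> real) \<Rightarrow> 'n \<Rightarrow> real" where
  "pull N \<phi> y = (\<lambda>i\<in>N. y (\<phi> i))"

definition push :: "'n set \<Rightarrow> 'm set \<Rightarrow> ('n \<Rightarrow> 'm) \<Rightarrow> ('n \<Rightarrow> real) \<Rightarrow> 'm \<Rightarrow> real" where
  "push N M \<phi> x = (\<lambda>j\<in>M. \<Sum>i\<in>{i\<in>N. \<phi> i = j}. x i)"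

text \<open>
  Minkowski sum and difference of subsets of \<open>\<real>\<^sup>N\<close>, and their pointwise versions for set-valued
  functions.
\<close>

definition minkowski_sum :: "'n set \<Rightarrow> ('n \<Rightarrow> real) set \<Rightarrow> ('n \<Rightarrow> real) set \<Rightarrow> ('n \<Rightarrow> real) set" where
  "minkowski_sum N A B = {\<lambda>i\<in>N. a i + b i | a b. a \<in> A \<and> b \<in> B}"

definition minkowski_neg :: "'n set \<Rightarrow> ('n \<Rightarrow> real) set \<Rightarrow> ('n \<Rightarrow> real) set" where
  "minkowski_neg N B = {\<lambda>i\<in>N. - b i | b. b \<in> B}"

definition minkowski_diff :: "'n set \<Rightarrow> ('n \<Rightarrow> real) set \<Rightarrow> ('n \<Rightarrow> real) set \<Rightarrow> ('n \<Rightarrow> real) set" where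
  "minkowski_diff N A B = minkowski_sum N A (minkowski_neg N B)"

definition fun_sum ::
  "'n set \<Rightarrow> ('x \<Rightarrow> ('n \<Rightarrow> real) set) \<Rightarrow> ('x \<Rightarrow> ('n \<Rightarrow> real) set) \<Rightarrow> 'x \<Rightarrow> ('n \<Rightarrow> real) set" where
  "fun_sum N u v = (\<lambda>x. minkowski_sum N (u x) (v x))"

definition fun_diff ::
  "'n set \<Rightarrow> ('x \<Rightarrow> ('n \<Rightarrow> real) set) \<Rightarrow> ('x \<Rightarrow> ('n \<Rightarrow> real) set) \<Rightarrow> 'x \<Rightarrow> ('n \<Rightarrow> real) set" where
  "fun_diff N u v = (\<lambda>x. minkowski_diff N (u x) (v x))"

definition eta :: "'x \<Rightarrow> 'x set" where
  "eta x = {x}"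

text \<open>The action of the covariant powerset functor on a function \<open>f\<close> is \<open>image f\<close>.\<close>

abbreviation Pmap :: "('x \<Rightarrow> 'y) \<Rightarrow> 'x set \<Rightarrow> 'y set" where
  "Pmap f \<equiv> image f"


section \<open>The functor\<close>

type_synonym 'n svf = "('n \<Rightarrow> real) \<Rightarrow> ('n \<Rightarrow> real) set"

definition ndd_ob :: "'n set \<Rightarrow> 'n svf set" where
  "ndd_ob N = Rvec N \<rightarrow>\<^sub>E Pow (Rvec N)"

definition ndd_map :: "'n set \<Rightarrow> 'm set \<Rightarrow> ('n \<Rightarrow> 'm) \<Rightarrow> 'n svf \<Rightarrow> 'm svf" where
  "ndd_map N M \<phi> \<upsilon> =
     restrict (fun_sum M eta (Pmap (push N M \<phi>) \<circ> fun_diff N \<upsilon> eta \<circ> pull N \<phi>)) (Rvec M)"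

definition ndd_mult ::
  "'a copr set \<Rightarrow> 'a copr set \<Rightarrow> 'a copr svf \<Rightarrow> 'a copr svf \<Rightarrow> 'a copr svf" where
  "ndd_mult N M \<upsilon> \<rho> =
     restrict (fun_sum (N \<oplus> M)
       (Pmap (push N (N \<oplus> M) Inj1) \<circ> \<upsilon> \<circ> pull N Inj1)
       (Pmap (push M (N \<oplus> M) Inj2) \<circ> \<rho> \<circ> pull M Inj2)) (Rvec (N \<oplus> M))"

definition ndd_unit :: "'n svf" where
  "ndd_unit = (\<lambda>x\<in>Rvec {}. {\<lambda>i\<in>{}. 0})"

definition NDD_D ::
  "('a copr set, 'a copr \<Rightarrow> 'a copr, 'a copr svf tup set, 'a copr svf tup \<Rightarrow> 'a copr svf tup)
     lax_functor_data" where
  "NDD_D = \<lparr>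
     FOb = (\<lambda>N. Base ` ndd_ob N),
     FHom = (\<lambda>N M \<phi>. \<lambda>z\<in>Base ` ndd_ob N. Base (ndd_map N M \<phi> (un_Base z))),
     Mult = (\<lambda>N M. \<lambda>z\<in>cprod (Base ` ndd_ob N) (Base ` ndd_ob M).
       Base (ndd_mult N M (un_Base (pr1 z)) (un_Base (pr2 z)))),
     UnitC = (\<lambda>z\<in>{Star}. Base ndd_unit)\<rparr>"

end

theory Submission
  imports Defs
begin

text \<open>
  Unfolding the Minkowski operations, the set assigned by the image of \<open>\<upsilon>\<close> under
  \<open>\<phi> : N \<rightarrow> M\<close> to a state \<open>y\<close> is
  \<open>{y + \<phi>\<^sub>* (a - \<phi>\<^sup>* y) | a. a \<in> \<upsilon> (\<phi>\<^sup>* y)}\<close>,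
  that is, the image of \<open>\<upsilon> (\<phi>\<^sup>* y)\<close> under the map \<open>a \<mapsto> y + \<phi>\<^sub>* (a - \<phi>\<^sup>* y)\<close>, called
  \<open>transport\<close> below: a possible next state \<open>a\<close> is turned into an increment, the increment is pushed
  forward, and the result is added to the current state. Likewise, under the identification of
  \<open>\<real>\<^sup>N \<times> \<real>\<^sup>M\<close> with \<open>\<real>\<^bsup>N+M\<^esup>\<close> (called \<open>join\<close>) the product comparison sends \<open>(\<upsilon>, \<rho>)\<close> to
  \<open>(x, y) \<mapsto> \<upsilon> x \<times> \<rho> y\<close>. So every functor law reduces to an identity between maps on vectors.

  Functoriality: in the composite of two transports, the state \<open>\<psi>\<^sup>* z\<close> added by the first one is
  subtracted again by the second one, and what remains is \<open>z + \<psi>\<^sub>* \<phi>\<^sub>* (a - \<phi>\<^sup>* \<psi>\<^sup>* z)\<close>; then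
  \<open>\<psi>\<^sub>* \<phi>\<^sub>* = (\<psi>\<phi>)\<^sub>*\<close> (\<open>push_compose\<close>, \<open>transport_compose\<close>). Naturality of the product comparison:
  transport along \<open>\<phi> + \<psi>\<close> acts on each of the two components separately (\<open>transport_join\<close>).
  Coherence: the structure maps of finite sets are bijections, and for a bijection
  \<open>\<phi>\<^sub>* \<phi>\<^sup>* = id\<close>, so the current state cancels and transport merely reindexes
  (\<open>transport_inverse\<close>). The coherence laws thus say that reindexing a joined vector rebrackets
  it, swaps its parts, or drops a part indexed by the empty set.
\<close>


section \<open>The two symmetric monoidal categories\<close>

text \<open>
  Both categories have all functions between sets, made extensional, as morphisms; the category laws
  and the criterion for isomorphisms are therefore shared.
\<close>

lemma category_of_functions:
  assumes "Hom C = (\<lambda>S T. S \<rightarrow>\<^sub>E T)" "Ident C = (\<lambda>S. \<lambda>s\<in>S. s)"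
    and "Cmp C = (\<lambda>S T U g f. compose S g f)"
  shows "category C"
proof
  fix W X Y Z f g h
  assume "f \<in> Hom C W X" "g \<in> Hom C X Y" "h \<in> Hom C Y Z"
  then show "Cmp C W Y Z h (Cmp C W X Y g f) = Cmp C W X Z (Cmp C X Y Z h g) f"
    unfolding assms by (auto simp: compose_assoc PiE_def)
qed (auto simp: assms compose_def fun_eq_iff PiE_def extensional_def restrict_def)

lemma is_iso_of_inverse:
  assumes "Hom C = (\<lambda>S T. S \<rightarrow>\<^sub>E T)" "Ident C = (\<lambda>S. \<lambda>s\<in>S. s)"
    and "Cmp C = (\<lambda>S T U g f. compose S g f)"
    and "f \<in> extensional S" "\<And>s. s \<in> S \<Longrightarrow> f s \<in> T \<and> g (f s) = s"
    and "\<And>t. t \<in> T \<Longrightarrow> g t \<in> S \<and> f (g t) = t"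
  shows "is_iso C S T f"
  unfolding is_iso_def assms(1-3)
proof (intro conjI bexI)
  show "restrict g T \<in> T \<rightarrow>\<^sub>E S" using assms(6) by auto
qed (use assms(4-6) in \<open>auto simp: compose_def PiE_def intro!: restrict_ext\<close>)

lemma Inj_in_dsum_iff [simp]:
  "Inj1 i \<in> N \<oplus> M \<longleftrightarrow> i \<in> N" "Inj2 j \<in> N \<oplus> M \<longleftrightarrow> j \<in> M" "Atom a \<notin> N \<oplus> M"
  by (auto simp: dsum_def)

lemma dsumE [elim!]:
  assumes "k \<in> N \<oplus> M"
  obtains i where "i \<in> N" "k = Inj1 i" | j where "j \<in> M" "k = Inj2 j"
  using assms by (auto simp: dsum_def)

lemma finite_dsum [simp]: "finite N \<Longrightarrow> finite M \<Longrightarrow> finite (N \<oplus> M)"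
  by (simp add: dsum_def)

lemma Pr_in_cprod_iff [simp]: "Pr s t \<in> cprod S T \<longleftrightarrow> s \<in> S \<and> t \<in> T"
  by (auto simp: cprod_def)

lemma cprodE [elim!]:
  assumes "z \<in> cprod S T"
  obtains s t where "z = Pr s t" "s \<in> S" "t \<in> T"
  using assms by (auto simp: cprod_def)

lemma FinSet_hom_fields: "Hom FinSet = (\<lambda>S T. S \<rightarrow>\<^sub>E T)" "Ident FinSet = (\<lambda>S. \<lambda>s\<in>S. s)"
   "Cmp FinSet = (\<lambda>S T U g f. compose S g f)"
  by (simp_all add: FinSet_def)

lemma SetCat_hom_fields: "Hom SetCat = (\<lambda>S T. S \<rightarrow>\<^sub>E T)" "Ident SetCat = (\<lambda>S. \<lambda>s\<in>S. s)"
   "Cmp SetCat = (\<lambda>S T U g f. compose S g f)"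
  by (simp_all add: SetCat_def)

lemma smc_FinSet: "symmetric_monoidal_category FinSet"
proof -
  interpret category FinSet by (rule category_of_functions) (simp_all add: FinSet_hom_fields)
  \<comment> \<open>Apart from invertibility, the laws are equations between functions restricted to the same iterated disjoint
    union, so a case distinction on the injections decides them; invertibility needs explicit inverses.\<close>
  show ?thesis
  proof
    fix X Y Z :: "'a copr set"
    show "is_iso FinSet ((X \<otimes>\<^bsub>FinSet\<^esub> Y) \<otimes>\<^bsub>FinSet\<^esub> Z) (X \<otimes>\<^bsub>FinSet\<^esub> (Y \<otimes>\<^bsub>FinSet\<^esub> Z)) (Assoc FinSet X Y Z)"
      by (rule is_iso_of_inverse[OF FinSet_hom_fields, where g = "\<lambda>k. case k of Inj1 i \<Rightarrow> Inj1 (Inj1 i)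
          | Inj2 (Inj1 j) \<Rightarrow> Inj1 (Inj2 j) | Inj2 (Inj2 l) \<Rightarrow> Inj2 l | _ \<Rightarrow> undefined"])
        (auto simp: FinSet_def)
    show "is_iso FinSet (Unit FinSet \<otimes>\<^bsub>FinSet\<^esub> X) X (LUnit FinSet X)"
      by (rule is_iso_of_inverse[OF FinSet_hom_fields, where g = Inj2]) (auto simp: FinSet_def)
    show "is_iso FinSet (X \<otimes>\<^bsub>FinSet\<^esub> Unit FinSet) X (RUnit FinSet X)"
      by (rule is_iso_of_inverse[OF FinSet_hom_fields, where g = Inj1]) (auto simp: FinSet_def)
  qed (auto simp: FinSet_def compose_def PiE_mem split: copr.splits intro!: restrict_ext)
qed

lemma smc_SetCat: "symmetric_monoidal_category SetCat"
proof -
  interpret category SetCat by (rule category_of_functions) (simp_all add: SetCat_hom_fields)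
  \<comment> \<open>As for finite sets, with elements written as nested pairs instead of nested injections.\<close>
  show ?thesis
  proof
    fix X Y Z :: "'a tup set"
    show "is_iso SetCat ((X \<otimes>\<^bsub>SetCat\<^esub> Y) \<otimes>\<^bsub>SetCat\<^esub> Z) (X \<otimes>\<^bsub>SetCat\<^esub> (Y \<otimes>\<^bsub>SetCat\<^esub> Z)) (Assoc SetCat X Y Z)"
      by (rule is_iso_of_inverse[OF SetCat_hom_fields,
            where g = "\<lambda>z. Pr (Pr (pr1 z) (pr1 (pr2 z))) (pr2 (pr2 z))"])
        (auto simp: SetCat_def)
    show "is_iso SetCat (Unit SetCat \<otimes>\<^bsub>SetCat\<^esub> X) X (LUnit SetCat X)"
      by (rule is_iso_of_inverse[OF SetCat_hom_fields, where g = "Pr Star"]) (auto simp: SetCat_def)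
    show "is_iso SetCat (X \<otimes>\<^bsub>SetCat\<^esub> Unit SetCat) X (RUnit SetCat X)"
      by (rule is_iso_of_inverse[OF SetCat_hom_fields, where g = "\<lambda>x. Pr x Star"]) (auto simp: SetCat_def)
  qed (auto simp: SetCat_def compose_def PiE_mem intro!: restrict_ext)
qed


section \<open>Sets of combined elements\<close>

lemma image_Collect2:
  "h ` {f a b | a b. a \<in> A \<and> b \<in> B} = {h (f a b) | a b. a \<in> A \<and> b \<in> B}"
  by blast

lemma Collect2_image:
  "{f a b | a b. a \<in> g ` A \<and> b \<in> h ` B} = {f (g a) (h b) | a b. a \<in> A \<and> b \<in> B}"
  by blast

text \<open>
  Elementwise associativity lifts to sets of combined elements. The operations may differ since the
  two bracketings of a threefold join live over different index sets.
\<close>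

lemma Collect2_assoc:
  assumes "\<And>a b c. f (g a b) c = h a (k b c)"
  shows "{f x c | x c. x \<in> {g a b | a b. a \<in> A \<and> b \<in> B} \<and> c \<in> C}
    = {h a y | a y. a \<in> A \<and> y \<in> {k b c | b c. b \<in> B \<and> c \<in> C}}"
proof -
  have "{f x c | x c. x \<in> {g a b | a b. a \<in> A \<and> b \<in> B} \<and> c \<in> C}
      = {f (g a b) c | a b c. a \<in> A \<and> b \<in> B \<and> c \<in> C}" by blast
  also have "\<dots> = {h a y | a y. a \<in> A \<and> y \<in> {k b c | b c. b \<in> B \<and> c \<in> C}}"
    unfolding assms by blast
  finally show ?thesis .
qed


section \<open>Pushing vectors forward and transporting them\<close>

lemma Rvec_iff: "x \<in> Rvec N \<longleftrightarrow> x \<in> extensional N"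
  by (auto simp: Rvec_def PiE_def)

lemma restrict_in_Rvec [simp]: "restrict x N \<in> Rvec N"
  by (simp add: Rvec_iff)

lemma pull_in_Rvec [simp]: "pull N \<phi> y \<in> Rvec N"
  by (simp add: Rvec_iff pull_def)

text \<open>
  Functoriality of \<open>\<phi> \<mapsto> \<phi>\<^sub>*\<close>: the fibre of \<open>\<psi> \<circ> \<phi>\<close> over \<open>l\<close> is the disjoint union of the fibres of \<open>\<phi>\<close>
  over the points of the fibre of \<open>\<psi>\<close> over \<open>l\<close>.
\<close>

lemma push_compose:
  assumes "finite N" "finite M" "\<phi> \<in> N \<rightarrow> M"
  shows "push N L (compose N \<psi> \<phi>) x = push M L \<psi> (push N M \<phi> x)"
  unfolding push_def
proof (rule restrict_ext)
  fix l
  \<comment> \<open>Restricting each inner sum to the fibre of the composite changes nothing, and prepares for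
    partitioning that fibre along \<open>\<phi>\<close>.\<close>
  have "(\<Sum>j\<in>{j \<in> M. \<psi> j = l}. \<Sum>i\<in>{i \<in> N. \<phi> i = j}. x i)
      = (\<Sum>j\<in>{j \<in> M. \<psi> j = l}. \<Sum>i\<in>{i \<in> {i \<in> N. \<psi> (\<phi> i) = l}. \<phi> i = j}. x i)"
    by (intro sum.cong) auto
  also have "\<dots> = (\<Sum>i\<in>{i \<in> N. \<psi> (\<phi> i) = l}. x i)"
    using assms by (intro sum.group) auto
  also have "\<dots> = (\<Sum>i\<in>{i \<in> N. compose N \<psi> \<phi> i = l}. x i)"
    by (intro sum.cong) (auto simp: compose_def)
  finally show "(\<Sum>i\<in>{i \<in> N. compose N \<psi> \<phi> i = l}. x i)
      = (\<Sum>j\<in>{j \<in> M. \<psi> j = l}. (\<lambda>j\<in>M. \<Sum>i\<in>{i \<in> N. \<phi> i = j}. x i) j)"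
    by simp
qed

text \<open>
  The fibres of a bijection are singletons, so summing over them is reindexing along the inverse.
\<close>

lemma push_inverse:
  assumes "\<And>i. i \<in> N \<Longrightarrow> \<phi> i \<in> M \<and> \<phi>' (\<phi> i) = i" "\<And>j. j \<in> M \<Longrightarrow> \<phi>' j \<in> N \<and> \<phi> (\<phi>' j) = j"
  shows "push N M \<phi> x = pull M \<phi>' x"
  unfolding push_def pull_def
proof (rule restrict_ext)
  fix j assume "j \<in> M"
  then have "{i \<in> N. \<phi> i = j} = {\<phi>' j}" using assms by auto
  then show "(\<Sum>i\<in>{i \<in> N. \<phi> i = j}. x i) = x (\<phi>' j)" by simp
qed

text \<open>
  The affine map \<open>a \<mapsto> y + \<phi>\<^sub>* (a - \<phi>\<^sup>* y)\<close>, with \<open>y\<close> the current state and \<open>a\<close> a possible next state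
  for \<open>\<phi>\<^sup>* y\<close>.
\<close>

definition transport :: "'n set \<Rightarrow> 'm set \<Rightarrow> ('n \<Rightarrow> 'm) \<Rightarrow> ('m \<Rightarrow> real) \<Rightarrow> ('n \<Rightarrow> real) \<Rightarrow> 'm \<Rightarrow> real" where
  "transport N M \<phi> y a = (\<lambda>j\<in>M. y j + push N M \<phi> (\<lambda>i\<in>N. a i - y (\<phi> i)) j)"

text \<open>
  Taking Minkowski sums and differences with the singletons \<open>\<eta> y\<close> only translates, so the whole
  action is the image under one map.
\<close>

lemma ndd_map_apply:
  assumes "y \<in> Rvec M"
  shows "ndd_map N M \<phi> \<upsilon> y = transport N M \<phi> y ` \<upsilon> (pull N \<phi> y)"
proof -
  have "(\<lambda>i\<in>N. a i + (\<lambda>i\<in>N. - pull N \<phi> y i) i) = (\<lambda>i\<in>N. a i - y (\<phi> i))" for a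
    by (auto simp: pull_def intro!: restrict_ext)
  then have "fun_diff N \<upsilon> eta (pull N \<phi> y) = (\<lambda>a. \<lambda>i\<in>N. a i - y (\<phi> i)) ` \<upsilon> (pull N \<phi> y)"
    by (auto simp: fun_diff_def minkowski_diff_def minkowski_sum_def minkowski_neg_def eta_def)
  then show ?thesis
    using assms
    by (auto simp: ndd_map_def fun_sum_def minkowski_sum_def eta_def transport_def)
qed

text \<open>
  The inner transport returns \<open>\<psi>\<^sup>* z\<close> plus an increment, and the outer one first subtracts \<open>\<psi>\<^sup>* z\<close>, so
  only the increment is pushed on.
\<close>

lemma transport_compose:
  assumes "finite N" "finite M" "\<phi> \<in> N \<rightarrow> M"
  shows "transport N L (compose N \<psi> \<phi>) z a
    = transport M L \<psi> z (transport N M \<phi> (pull M \<psi> z) a)"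
proof -
  have *: "(\<lambda>i\<in>N. a i - z (compose N \<psi> \<phi> i)) = (\<lambda>i\<in>N. a i - pull M \<psi> z (\<phi> i))"
    using assms(3) by (auto simp: pull_def compose_def intro!: restrict_ext)
  have "(\<lambda>j\<in>M. transport N M \<phi> (pull M \<psi> z) a j - z (\<psi> j))
      = push N M \<phi> (\<lambda>i\<in>N. a i - pull M \<psi> z (\<phi> i))"
    by (auto simp: transport_def pull_def push_def intro!: restrict_ext)
  then show ?thesis
    unfolding transport_def[of N L] transport_def[of M L] push_compose[OF assms] * by simp
qed

text \<open>
  For a bijection \<open>\<phi>\<^sub>* \<phi>\<^sup>* y = y\<close>, so the current state \<open>y\<close> cancels.
\<close>

lemma transport_inverse:
  assumes "\<And>i. i \<in> N \<Longrightarrow> \<phi> i \<in> M \<and> \<phi>' (\<phi> i) = i" "\<And>j. j \<in> M \<Longrightarrow> \<phi>' j \<in> N \<and> \<phi> (\<phi>' j) = j"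
  shows "transport N M \<phi> y a = pull M \<phi>' a"
proof -
  have "transport N M \<phi> y a = (\<lambda>j\<in>M. y j + pull M \<phi>' (\<lambda>i\<in>N. a i - y (\<phi> i)) j)"
    unfolding transport_def using push_inverse[of N \<phi> M \<phi>'] assms by simp
  also have "\<dots> = pull M \<phi>' a"
    using assms(2) by (auto simp: pull_def intro!: restrict_ext)
  finally show ?thesis .
qed


section \<open>Vectors on a disjoint union\<close>

definition join :: "'a copr set \<Rightarrow> 'a copr set \<Rightarrow> ('a copr \<Rightarrow> real) \<Rightarrow> ('a copr \<Rightarrow> real) \<Rightarrow> 'a copr \<Rightarrow> real" where
  "join N M a b = (\<lambda>k\<in>N \<oplus> M. case k of Inj1 i \<Rightarrow> a i | Inj2 j \<Rightarrow> b j | _ \<Rightarrow> undefined)"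

lemma join_Inj [simp]:
  "i \<in> N \<Longrightarrow> join N M a b (Inj1 i) = a i" "j \<in> M \<Longrightarrow> join N M a b (Inj2 j) = b j"
  by (simp_all add: join_def)

lemma join_in_Rvec [simp]: "join N M a b \<in> Rvec (N \<oplus> M)"
  by (simp add: Rvec_iff join_def)

lemma Rvec_dsum_eqI:
  assumes "x \<in> Rvec (N \<oplus> M)" "y \<in> Rvec (N \<oplus> M)"
    and "\<And>i. i \<in> N \<Longrightarrow> x (Inj1 i) = y (Inj1 i)" "\<And>j. j \<in> M \<Longrightarrow> x (Inj2 j) = y (Inj2 j)"
  shows "x = y"
  using assms by (intro extensionalityI[of x "N \<oplus> M"]) (auto simp: Rvec_iff)

text \<open>
  Pushing forward along an injection extends by zero, which is why the Minkowski sum in the product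
  comparison is a product of sets.
\<close>

lemma push_Inj:
  "push N (N \<oplus> M) Inj1 a = join N M a (\<lambda>_. 0)"
  "push M (N \<oplus> M) Inj2 b = join N M (\<lambda>_. 0) b"
  unfolding push_def join_def by (auto simp: Collect_conv_if intro!: restrict_ext)

lemma ndd_mult_apply:
  assumes "z \<in> Rvec (N \<oplus> M)"
  shows "ndd_mult N M \<upsilon> \<rho> z
    = {join N M a b | a b. a \<in> \<upsilon> (pull N Inj1 z) \<and> b \<in> \<rho> (pull M Inj2 z)}"
proof -
  have "(\<lambda>k\<in>N \<oplus> M. join N M a (\<lambda>_. 0) k + join N M (\<lambda>_. 0) b k) = join N M a b" for a b
    by (rule Rvec_dsum_eqI[of _ N M]) (auto simp: Rvec_iff join_def)
  then have "minkowski_sum (N \<oplus> M) (push N (N \<oplus> M) Inj1 ` A) (push M (N \<oplus> M) Inj2 ` B)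
      = {join N M a b | a b. a \<in> A \<and> b \<in> B}" for A B
    unfolding minkowski_sum_def push_Inj Collect2_image by simp
  then show ?thesis
    using assms by (simp add: ndd_mult_def fun_sum_def)
qed


section \<open>Functoriality\<close>

lemma ndd_ob_eqI:
  "\<lbrakk>\<upsilon> \<in> ndd_ob N; \<rho> \<in> ndd_ob N; \<And>x. x \<in> Rvec N \<Longrightarrow> \<upsilon> x = \<rho> x\<rbrakk> \<Longrightarrow> \<upsilon> = \<rho>"
  unfolding ndd_ob_def by (rule PiE_ext)

lemma ndd_ob_mem: "\<lbrakk>\<upsilon> \<in> ndd_ob N; x \<in> Rvec N; a \<in> \<upsilon> x\<rbrakk> \<Longrightarrow> a \<in> Rvec N"
  unfolding ndd_ob_def by auto

lemma transport_in_Rvec [simp]: "transport N M \<phi> y a \<in> Rvec M"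
  by (simp add: Rvec_iff transport_def)

lemma ndd_map_in [simp]: "ndd_map N M \<phi> \<upsilon> \<in> ndd_ob M"
  unfolding ndd_ob_def
proof (rule PiE_I)
  show "ndd_map N M \<phi> \<upsilon> y \<in> Pow (Rvec M)" if "y \<in> Rvec M" for y
    using that by (auto simp: ndd_map_apply)
qed (simp add: ndd_map_def)

lemma ndd_mult_in [simp]: "ndd_mult N M \<upsilon> \<rho> \<in> ndd_ob (N \<oplus> M)"
  unfolding ndd_ob_def
proof (rule PiE_I)
  show "ndd_mult N M \<upsilon> \<rho> z \<in> Pow (Rvec (N \<oplus> M))" if "z \<in> Rvec (N \<oplus> M)" for z
    using that by (auto simp: ndd_mult_apply)
qed (simp add: ndd_mult_def)

lemma ndd_unit_in [simp]: "ndd_unit \<in> ndd_ob {}"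
  by (auto simp: ndd_unit_def ndd_ob_def)

lemma ndd_map_compose:
  assumes "finite N" "finite M" "\<phi> \<in> N \<rightarrow> M"
  shows "ndd_map N L (compose N \<psi> \<phi>) \<upsilon> = ndd_map M L \<psi> (ndd_map N M \<phi> \<upsilon>)"
proof (rule ndd_ob_eqI)
  fix z assume z: "z \<in> Rvec L"
  have "pull N (compose N \<psi> \<phi>) z = pull N \<phi> (pull M \<psi> z)"
    using assms(3) by (auto simp: pull_def compose_def intro!: restrict_ext)
  with z show "ndd_map N L (compose N \<psi> \<phi>) \<upsilon> z = ndd_map M L \<psi> (ndd_map N M \<phi> \<upsilon>) z"
    by (simp add: ndd_map_apply image_image transport_compose[OF assms])
qed simp_all

text \<open>
  Along a bijection the functor acts by conjugation with reindexing. This covers the identity and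
  every structure map of finite sets.
\<close>

lemma ndd_map_inverse_apply:
  assumes "\<And>i. i \<in> N \<Longrightarrow> \<phi> i \<in> M \<and> \<phi>' (\<phi> i) = i" "\<And>j. j \<in> M \<Longrightarrow> \<phi>' j \<in> N \<and> \<phi> (\<phi>' j) = j"
    and "y \<in> Rvec M"
  shows "ndd_map N M \<phi> \<upsilon> y = pull M \<phi>' ` \<upsilon> (pull N \<phi> y)"
  using transport_inverse[of N \<phi> M \<phi>'] assms by (simp add: ndd_map_apply)

lemma ndd_map_Ident:
  assumes "\<upsilon> \<in> ndd_ob N"
  shows "ndd_map N N (\<lambda>i\<in>N. i) \<upsilon> = \<upsilon>"
proof (rule ndd_ob_eqI)
  fix x assume x: "x \<in> Rvec N"
  have id: "pull N (\<lambda>i. i) a = a" "pull N (\<lambda>i\<in>N. i) a = a" if "a \<in> Rvec N" for a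
    using that by (auto simp: pull_def Rvec_iff extensional_def fun_eq_iff)
  have "ndd_map N N (\<lambda>i\<in>N. i) \<upsilon> x = pull N (\<lambda>i. i) ` \<upsilon> (pull N (\<lambda>i\<in>N. i) x)"
    using x by (intro ndd_map_inverse_apply) auto
  also have "\<dots> = \<upsilon> x"
    using ndd_ob_mem[OF assms x] x by (simp add: id)
  finally show "ndd_map N N (\<lambda>i\<in>N. i) \<upsilon> x = \<upsilon> x" .
qed (use assms in simp_all)


section \<open>Naturality of the product comparison\<close>

text \<open>
  The fibre of \<open>\<phi> + \<psi>\<close> over a point of one summand lies entirely in the corresponding summand of
  the domain.
\<close>

lemma push_TenM_Inj:
  fixes \<phi> :: "'a copr \<Rightarrow> 'a copr"
  shows "i \<in> N' \<Longrightarrow> push (N \<oplus> M) (N' \<oplus> M') (TenM FinSet N N' M M' \<phi> \<psi>) x (Inj1 i)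
      = push N N' \<phi> (pull N Inj1 x) i"
    and "j \<in> M' \<Longrightarrow> push (N \<oplus> M) (N' \<oplus> M') (TenM FinSet N N' M M' \<phi> \<psi>) x (Inj2 j)
      = push M M' \<psi> (pull M Inj2 x) j"
proof -
  let ?t = "TenM FinSet N N' M M' \<phi> \<psi>"
  have "{k \<in> N \<oplus> M. ?t k = Inj1 i} = Inj1 ` {i' \<in> N. \<phi> i' = i}"
    by (auto simp: FinSet_def)
  then show "push (N \<oplus> M) (N' \<oplus> M') ?t x (Inj1 i) = push N N' \<phi> (pull N Inj1 x) i" if "i \<in> N'"
    using that by (simp add: push_def pull_def sum.reindex inj_on_def)
  have "{k \<in> N \<oplus> M. ?t k = Inj2 j} = Inj2 ` {j' \<in> M. \<psi> j' = j}"
    by (auto simp: FinSet_def)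
  then show "push (N \<oplus> M) (N' \<oplus> M') ?t x (Inj2 j) = push M M' \<psi> (pull M Inj2 x) j" if "j \<in> M'"
    using that by (simp add: push_def pull_def sum.reindex inj_on_def)
qed

text \<open>
  Both pulling back and pushing forward along \<open>\<phi> + \<psi>\<close> keep the two summands apart, so transport
  does as well.
\<close>

lemma transport_join:
  assumes "\<phi> \<in> N \<rightarrow> N'" "\<psi> \<in> M \<rightarrow> M'"
  shows "transport (N \<oplus> M) (N' \<oplus> M') (TenM FinSet N N' M M' \<phi> \<psi>) z (join N M a b)
    = join N' M' (transport N N' \<phi> (pull N' Inj1 z) a) (transport M M' \<psi> (pull M' Inj2 z) b)"
proof -
  let ?d = "\<lambda>k\<in>N \<oplus> M. join N M a b k - z (TenM FinSet N N' M M' \<phi> \<psi> k)"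
  have "pull N Inj1 ?d = (\<lambda>i\<in>N. a i - pull N' Inj1 z (\<phi> i))"
    "pull M Inj2 ?d = (\<lambda>j\<in>M. b j - pull M' Inj2 z (\<psi> j))"
    using assms by (auto simp: pull_def FinSet_def intro!: restrict_ext)
  then show ?thesis
    by (intro Rvec_dsum_eqI[of _ N' M']) (simp_all add: transport_def push_TenM_Inj, simp_all add: pull_def)
qed

lemma ndd_mult_natural:
  assumes "\<phi> \<in> N \<rightarrow> N'" "\<psi> \<in> M \<rightarrow> M'"
  shows "ndd_mult N' M' (ndd_map N N' \<phi> \<upsilon>) (ndd_map M M' \<psi> \<rho>)
    = ndd_map (N \<oplus> M) (N' \<oplus> M') (TenM FinSet N N' M M' \<phi> \<psi>) (ndd_mult N M \<upsilon> \<rho>)"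
proof (rule ndd_ob_eqI)
  fix z assume z: "z \<in> Rvec (N' \<oplus> M')"
  let ?t = "TenM FinSet N N' M M' \<phi> \<psi>"
  have "pull N Inj1 (pull (N \<oplus> M) ?t z) = pull N \<phi> (pull N' Inj1 z)"
    "pull M Inj2 (pull (N \<oplus> M) ?t z) = pull M \<psi> (pull M' Inj2 z)"
    using assms by (auto simp: pull_def FinSet_def intro!: restrict_ext)
  then show "ndd_mult N' M' (ndd_map N N' \<phi> \<upsilon>) (ndd_map M M' \<psi> \<rho>) z
      = ndd_map (N \<oplus> M) (N' \<oplus> M') ?t (ndd_mult N M \<upsilon> \<rho>) z"
    using z
    by (simp add: ndd_mult_apply ndd_map_apply image_Collect2 Collect2_image transport_join[OF assms]
        del: mem_Collect_eq)
qed simp_all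


section \<open>Coherence of the comparison maps\<close>

lemma ndd_mult_Assoc:
  "ndd_map ((N \<oplus> M) \<oplus> L) (N \<oplus> (M \<oplus> L)) (Assoc FinSet N M L)
      (ndd_mult (N \<oplus> M) L (ndd_mult N M \<upsilon> \<rho>) \<sigma>)
    = ndd_mult N (M \<oplus> L) \<upsilon> (ndd_mult M L \<rho> \<sigma>)"
proof (rule ndd_ob_eqI)
  fix z assume z: "z \<in> Rvec (N \<oplus> (M \<oplus> L))"
  let ?\<alpha> = "Assoc FinSet N M L"
  \<comment> \<open>the inverse of \<open>?\<alpha>\<close>\<close>
  let ?\<beta> = "\<lambda>k. case k of Inj1 i \<Rightarrow> Inj1 (Inj1 i) | Inj2 (Inj1 j) \<Rightarrow> Inj1 (Inj2 j)
    | Inj2 (Inj2 l) \<Rightarrow> Inj2 l | _ \<Rightarrow> undefined"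
  have map: "ndd_map ((N \<oplus> M) \<oplus> L) (N \<oplus> (M \<oplus> L)) ?\<alpha> \<tau> z
      = pull (N \<oplus> (M \<oplus> L)) ?\<beta> ` \<tau> (pull ((N \<oplus> M) \<oplus> L) ?\<alpha> z)" for \<tau>
    using z by (intro ndd_map_inverse_apply) (auto simp: FinSet_def)
  have join: "pull (N \<oplus> (M \<oplus> L)) ?\<beta> (join (N \<oplus> M) L (join N M a b) c)
      = join N (M \<oplus> L) a (join M L b c)" for a b c
    by (rule Rvec_dsum_eqI[of _ N "M \<oplus> L"]) (auto simp: pull_def)
  have "pull N Inj1 (pull (N \<oplus> M) Inj1 (pull ((N \<oplus> M) \<oplus> L) ?\<alpha> z)) = pull N Inj1 z"
    "pull M Inj2 (pull (N \<oplus> M) Inj1 (pull ((N \<oplus> M) \<oplus> L) ?\<alpha> z))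
      = pull M Inj1 (pull (M \<oplus> L) Inj2 z)"
    "pull L Inj2 (pull ((N \<oplus> M) \<oplus> L) ?\<alpha> z) = pull L Inj2 (pull (M \<oplus> L) Inj2 z)"
    by (auto simp: pull_def FinSet_def intro!: restrict_ext)
  then show "ndd_map ((N \<oplus> M) \<oplus> L) (N \<oplus> (M \<oplus> L)) ?\<alpha>
        (ndd_mult (N \<oplus> M) L (ndd_mult N M \<upsilon> \<rho>) \<sigma>) z
      = ndd_mult N (M \<oplus> L) \<upsilon> (ndd_mult M L \<rho> \<sigma>) z"
    using z
    by (simp add: map ndd_mult_apply image_Collect2 del: mem_Collect_eq)
      (rule Collect2_assoc[where g = "join N M" and k = "join M L"], rule join)
qed simp_all

lemma ndd_mult_Sym:
  "ndd_map (N \<oplus> M) (M \<oplus> N) (Sym FinSet N M) (ndd_mult N M \<upsilon> \<rho>) = ndd_mult M N \<rho> \<upsilon>"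
proof (rule ndd_ob_eqI)
  fix z assume z: "z \<in> Rvec (M \<oplus> N)"
  have map: "ndd_map (N \<oplus> M) (M \<oplus> N) (Sym FinSet N M) \<tau> z
      = pull (M \<oplus> N) (Sym FinSet M N) ` \<tau> (pull (N \<oplus> M) (Sym FinSet N M) z)" for \<tau>
    using z by (intro ndd_map_inverse_apply) (auto simp: FinSet_def)
  have join: "pull (M \<oplus> N) (Sym FinSet M N) (join N M a b) = join M N b a" for a b
    by (rule Rvec_dsum_eqI[of _ M N]) (auto simp: pull_def FinSet_def)
  have "pull N Inj1 (pull (N \<oplus> M) (Sym FinSet N M) z) = pull N Inj2 z"
    "pull M Inj2 (pull (N \<oplus> M) (Sym FinSet N M) z) = pull M Inj1 z"
    by (auto simp: pull_def FinSet_def intro!: restrict_ext)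
  then show "ndd_map (N \<oplus> M) (M \<oplus> N) (Sym FinSet N M) (ndd_mult N M \<upsilon> \<rho>) z
      = ndd_mult M N \<rho> \<upsilon> z"
    using z by (simp add: map ndd_mult_apply image_Collect2 join) blast
qed simp_all

lemma ndd_unit_apply: "ndd_unit (pull {} \<phi> x) = {\<lambda>i\<in>{}. 0}"
  by (simp add: ndd_unit_def)

text \<open>
  The unit comparison contributes the only vector indexed by the empty set, so joining with it and
  reindexing along the injection gives back each next state.
\<close>

lemma ndd_mult_LUnit:
  assumes \<upsilon>: "\<upsilon> \<in> ndd_ob N"
  shows "ndd_map ({} \<oplus> N) N (LUnit FinSet N) (ndd_mult {} N ndd_unit \<upsilon>) = \<upsilon>"
proof (rule ndd_ob_eqI)
  fix x assume x: "x \<in> Rvec N"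
  have map: "ndd_map ({} \<oplus> N) N (LUnit FinSet N) \<tau> x
      = pull N Inj2 ` \<tau> (pull ({} \<oplus> N) (LUnit FinSet N) x)" for \<tau>
    using x by (intro ndd_map_inverse_apply) (auto simp: FinSet_def)
  have join: "pull N Inj2 (join {} N o' a) = a" if "a \<in> \<upsilon> x" for o' a
    using ndd_ob_mem[OF \<upsilon> x that]
    by (auto simp: pull_def Rvec_iff intro: extensionalityI)
  have "pull N Inj2 (pull ({} \<oplus> N) (LUnit FinSet N) x) = x"
    using x by (auto simp: pull_def FinSet_def Rvec_iff intro: extensionalityI)
  then have "ndd_map ({} \<oplus> N) N (LUnit FinSet N) (ndd_mult {} N ndd_unit \<upsilon>) x
      = pull N Inj2 ` {join {} N a b | a b. a \<in> {\<lambda>i\<in>{}. 0} \<and> b \<in> \<upsilon> x}"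
    by (simp add: map ndd_mult_apply ndd_unit_apply)
  also have "\<dots> = (\<lambda>b. pull N Inj2 (join {} N (\<lambda>i\<in>{}. 0) b)) ` \<upsilon> x"
    by blast
  also have "\<dots> = \<upsilon> x"
    using join by simp
  finally show "ndd_map ({} \<oplus> N) N (LUnit FinSet N) (ndd_mult {} N ndd_unit \<upsilon>) x = \<upsilon> x" .
qed (use \<upsilon> in simp_all)

lemma ndd_mult_RUnit:
  assumes \<upsilon>: "\<upsilon> \<in> ndd_ob N"
  shows "ndd_map (N \<oplus> {}) N (RUnit FinSet N) (ndd_mult N {} \<upsilon> ndd_unit) = \<upsilon>"
proof (rule ndd_ob_eqI)
  fix x assume x: "x \<in> Rvec N"
  have map: "ndd_map (N \<oplus> {}) N (RUnit FinSet N) \<tau> x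
      = pull N Inj1 ` \<tau> (pull (N \<oplus> {}) (RUnit FinSet N) x)" for \<tau>
    using x by (intro ndd_map_inverse_apply) (auto simp: FinSet_def)
  have join: "pull N Inj1 (join N {} a o') = a" if "a \<in> \<upsilon> x" for o' a
    using ndd_ob_mem[OF \<upsilon> x that]
    by (auto simp: pull_def Rvec_iff intro: extensionalityI)
  have "pull N Inj1 (pull (N \<oplus> {}) (RUnit FinSet N) x) = x"
    using x by (auto simp: pull_def FinSet_def Rvec_iff intro: extensionalityI)
  then have "ndd_map (N \<oplus> {}) N (RUnit FinSet N) (ndd_mult N {} \<upsilon> ndd_unit) x
      = pull N Inj1 ` {join N {} a b | a b. a \<in> \<upsilon> x \<and> b \<in> {\<lambda>i\<in>{}. 0}}"
    by (simp add: map ndd_mult_apply ndd_unit_apply)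
  also have "\<dots> = (\<lambda>a. pull N Inj1 (join N {} a (\<lambda>i\<in>{}. 0))) ` \<upsilon> x"
    by blast
  also have "\<dots> = \<upsilon> x"
    using join by simp
  finally show "ndd_map (N \<oplus> {}) N (RUnit FinSet N) (ndd_mult N {} \<upsilon> ndd_unit) x = \<upsilon> x" .
qed (use \<upsilon> in simp_all)

lemma FinSet_tensor_fields: "Ob FinSet = {N. finite N}" "Ten FinSet = (\<oplus>)" "Unit FinSet = {}"
  by (simp_all add: FinSet_def)


section \<open>The lax symmetric monoidal functor\<close>

theorem lemma5p4:
  shows "lax_symmetric_monoidal_functor
    (FinSet :: ('a copr set, 'a copr \<Rightarrow> 'a copr) smcat)
    (SetCat :: ('a copr svf tup set, 'a copr svf tup \<Rightarrow> 'a copr svf tup) smcat)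
    NDD_D"
proof -
  interpret C: symmetric_monoidal_category "FinSet :: ('a copr set, 'a copr \<Rightarrow> 'a copr) smcat"
    by (rule smc_FinSet)
  interpret D: symmetric_monoidal_category
    "SetCat :: ('a copr svf tup set, 'a copr svf tup \<Rightarrow> 'a copr svf tup) smcat"
    by (rule smc_SetCat)
  \<comment> \<open>Evaluated at elements \<open>Base \<upsilon>\<close> and \<open>Pr (Base \<upsilon>) (Base \<rho>)\<close>, each law is one of the equations
    between set-valued functions established above.\<close>
  show ?thesis
    by unfold_locales
      (auto simp: FinSet_hom_fields FinSet_tensor_fields SetCat_def NDD_D_def compose_def[of "_ :: _ tup set"]
        ndd_map_Ident ndd_map_compose ndd_mult_natural ndd_mult_Assoc ndd_mult_LUnit ndd_mult_RUnit
        ndd_mult_Sym PiE_iff Pi_iff intro!: restrict_ext)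
qed

end
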